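(* Let $\tilde L\in\mathbb{R}^{n\times n}$ be a standardized Laplacian matrix, let $J\in\mathbb{R}^{n\times n}$ be the matrix all of whose entries equal $1/n$, let $P=\tilde L+J$ and $\tilde L_c=(I-J)-\tilde L$. Then for every complex number $\lambda\notin\{0,1\}$ the following are equivalent: (a) $\lambda$ is an eigenvalue of $\tilde L$; (b) $\lambda$ is an eigenvalue of $P$; (c) $1-\lambda$ is an eigenvalue of $\tilde L_c$. Moreover, these eigenvalues ($\lambda$ for $\tilde L$, $\lambda$ for $P$, $1-\lambda$ for $\tilde L_c$) have the same geometric multiplicity. Furthermore, for $\lambda\notin\{0,1\}$, a vector $v$ is an eigenvector of $\tilde L$ corresponding to $\lambda$ if and only if the vector $x=\left(I-\frac{J}{1-\lambda}\right)v$ is an eigenvector of $P$ corresponding to $\lambda$ and of $\tilde L_c$ corresponding to $1-\lambda$.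
   Context: A standardized Laplacian matrix of order $n$ is a real matrix $\tilde L=(\ell_{ij})\in\mathbb{R}^{n\times n}$ such that $-\frac1n\le \ell_{ij}\le 0$ for all $j\ne i$ and $\sum_{j=1}^n \ell_{ij}=0$ for every $i$. $I$ denotes the $n\times n$ identity matrix. (The matrix $P$ is then stochastic and $\tilde L_c$ is again a standardized Laplacian matrix.) Eigenvectors are taken in $\mathbb{C}^n$ and are nonzero. *)

theory Defs
  imports Complex_Main "Jordan_Normal_Form.Char_Poly" "Jordan_Normal_Form.Matrix_Kernel"
begin

definition standardized_laplacian :: "nat \<Rightarrow> real mat \<Rightarrow> bool" where
  "standardized_laplacian n L \<longleftrightarrow>
     L \<in> carrier_mat n n \<and>
     (\<forall>i<n. \<forall>j<n. j \<noteq> i \<longrightarrow> - 1 / real n \<le> L $$ (i, j) \<and> L $$ (i, j) \<le> 0) \<and>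
     (\<forall>i<n. (\<Sum>j<n. L $$ (i, j)) = 0)"

abbreviation cmat :: "real mat \<Rightarrow> complex mat" where
  "cmat A \<equiv> map_mat complex_of_real A"

(* char_matrix A k is A - k I, so its kernel is the eigenspace of A for k. *)
definition geometric_multiplicity :: "'a :: field mat \<Rightarrow> 'a \<Rightarrow> nat" where
  "geometric_multiplicity A k = kernel_dim (char_matrix A k)"

end

theory Submission
  imports Defs
begin

text \<open>
  Since all rows of \<open>L\<close> sum to zero, \<open>L J = 0\<close>, while \<open>J\<^sup>2 = J\<close>. Hence \<open>K = I - J / (1 - \<mu>)\<close> is
  invertible with inverse \<open>I - J / \<mu>\<close>, and \<open>(P - \<mu> I) K = L - \<mu> I\<close>: thus \<open>K\<close> maps the eigenspace
  of \<open>L\<close> isomorphically onto that of \<open>P\<close>. Moreover \<open>L\<^sub>c - (1 - \<mu>) I = - (P - \<mu> I)\<close>, so the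
  eigenspaces of \<open>P\<close> and \<open>L\<^sub>c\<close> coincide.
\<close>

lemma mult_one_minus_smult_mat:
  fixes A B :: "'a :: field mat"
  assumes "A \<in> carrier_mat n n" "B \<in> carrier_mat n n"
  shows "A * (1\<^sub>m n - c \<cdot>\<^sub>m B) = A - c \<cdot>\<^sub>m (A * B)"
  using assms by (simp add: mult_minus_distrib_mat[of _ n n _ n] mult_smult_distrib[of _ n n _ n])

text \<open>Expanding with \<open>J * J = J\<close> leaves I - (c + d - c d) J, so the condition on
  \<open>c\<close> and \<open>d\<close> is exactly what makes the J term vanish. It is symmetric in
  \<open>c\<close> and \<open>d\<close>, hence serves for both orders of the factors.\<close>

lemma one_minus_smult_idempotent_mult:
  fixes J :: "'a :: field mat"
  assumes J: "J \<in> carrier_mat n n" and JJ: "J * J = J" and "c + d = c * d"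
  shows "(1\<^sub>m n - c \<cdot>\<^sub>m J) * (1\<^sub>m n - d \<cdot>\<^sub>m J) = 1\<^sub>m n"
proof -
  have "(1\<^sub>m n - c \<cdot>\<^sub>m J) * J = J - c \<cdot>\<^sub>m J"
    using J JJ by (simp add: minus_mult_distrib_mat[of _ n n _ _ n] mult_smult_assoc_mat[of _ n n _ n])
  then have "(1\<^sub>m n - c \<cdot>\<^sub>m J) * (1\<^sub>m n - d \<cdot>\<^sub>m J) = (1\<^sub>m n - c \<cdot>\<^sub>m J) - d \<cdot>\<^sub>m (J - c \<cdot>\<^sub>m J)"
    using mult_one_minus_smult_mat[of "1\<^sub>m n - c \<cdot>\<^sub>m J" n J d] J by (simp add: minus_carrier_mat)
  also have "\<dots> = 1\<^sub>m n"
  proof (rule eq_matI)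
    fix i j assume "i < dim_row (1\<^sub>m n :: 'a mat)" "j < dim_col (1\<^sub>m n :: 'a mat)"
    moreover have "c * x + d * (x - c * x) = 0" for x
    proof -
      have "c * x + d * (x - c * x) = (c + d - c * d) * x" by (simp add: algebra_simps)
      then show ?thesis using assms(3) by simp
    qed
    ultimately show "((1\<^sub>m n - c \<cdot>\<^sub>m J) - d \<cdot>\<^sub>m (J - c \<cdot>\<^sub>m J)) $$ (i, j) = 1\<^sub>m n $$ (i, j)"
      using J by (simp add: diff_diff_eq)
  qed (use J in auto)
  finally show ?thesis .
qed

text \<open>From \<open>L * J = 0\<close> and \<open>J * J = J\<close>, the product (L + J - \<mu>
  I) J collapses to (1 - \<mu>) J. Dividing by 1 - \<mu> therefore makes the correction term exactly
  J, and subtracting it turns L + J back into L.\<close>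

lemma char_matrix_add_mult_one_minus_smult:
  fixes L J :: "'a :: field mat"
  assumes L: "L \<in> carrier_mat n n" and J: "J \<in> carrier_mat n n"
    and LJ: "L * J = 0\<^sub>m n n" and JJ: "J * J = J" and "\<mu> \<noteq> 1"
  shows "char_matrix (L + J) \<mu> * (1\<^sub>m n - (1 / (1 - \<mu>)) \<cdot>\<^sub>m J) = char_matrix L \<mu>"
proof -
  have "char_matrix (L + J) \<mu> * J = J + (-\<mu>) \<cdot>\<^sub>m J"
    using L J LJ JJ unfolding char_matrix_def
    by (simp add: add_mult_distrib_mat[of _ n n _ _ n] mult_smult_assoc_mat[of _ n n _ n])
  then have "char_matrix (L + J) \<mu> * (1\<^sub>m n - (1 / (1 - \<mu>)) \<cdot>\<^sub>m J)
      = char_matrix (L + J) \<mu> - (1 / (1 - \<mu>)) \<cdot>\<^sub>m (J + (-\<mu>) \<cdot>\<^sub>m J)"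
    using L J by (simp add: mult_one_minus_smult_mat)
  also have "\<dots> = char_matrix L \<mu>"
  proof (rule eq_matI)
    fix i j assume "i < dim_row (char_matrix L \<mu>)" "j < dim_col (char_matrix L \<mu>)"
    moreover have "1 / (1 - \<mu>) * (x + (-\<mu>) * x) = x" for x
      using \<open>\<mu> \<noteq> 1\<close> by (simp add: field_simps)
    ultimately show "(char_matrix (L + J) \<mu> - (1 / (1 - \<mu>)) \<cdot>\<^sub>m (J + (-\<mu>) \<cdot>\<^sub>m J)) $$ (i, j)
        = char_matrix L \<mu> $$ (i, j)"
      using L J by (simp add: char_matrix_def)
  qed (use L J in \<open>auto simp: char_matrix_def\<close>)
  finally show ?thesis .
qed

lemma char_matrix_complement:
  fixes L J :: "'a :: field mat"
  assumes "L \<in> carrier_mat n n" "J \<in> carrier_mat n n"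
  shows "char_matrix ((1\<^sub>m n - J) - L) (1 - \<mu>) = - char_matrix (L + J) \<mu>"
  using assms by (intro eq_matI) (auto simp: char_matrix_def)

lemma mat_kernel_uminus:
  fixes A :: "'a :: field mat"
  shows "mat_kernel (- A) = mat_kernel A"
proof -
  have "(- A) *\<^sub>v v = 0\<^sub>v (dim_row A) \<longleftrightarrow> A *\<^sub>v v = 0\<^sub>v (dim_row A)"
    if "v \<in> carrier_vec (dim_col A)" for v
    using that by (auto simp: vec_eq_iff)
  then show ?thesis by (auto simp: mat_kernel_def)
qed

text \<open>In this form an equality of kernels carries over to eigenvectors directly, even for
  different matrices and eigenvalues.\<close>

lemma eigenvector_mat_kernel:
  fixes A :: "'a :: field mat"
  assumes "A \<in> carrier_mat n n"
  shows "eigenvector A v k \<longleftrightarrow> v \<noteq> 0\<^sub>v n \<and> v \<in> mat_kernel (char_matrix A k)"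
  using eigenvector_char_matrix[OF assms] mat_kernel[OF char_matrix_closed[OF assms]] by auto

text \<open>Eigenvectors must be nonzero, and this carries that condition between \<open>v\<close>
  and its image under \<open>K\<close>: applying \<open>K'\<close> to the image recovers
  \<open>v\<close>.\<close>

lemma mult_invertible_mat_vec_eq_0_iff:
  fixes K :: "'a :: field mat"
  assumes K: "K \<in> carrier_mat n n" and K': "K' \<in> carrier_mat n n" and inv: "K' * K = 1\<^sub>m n"
    and v: "v \<in> carrier_vec n"
  shows "K *\<^sub>v v = 0\<^sub>v n \<longleftrightarrow> v = 0\<^sub>v n"
proof
  assume "K *\<^sub>v v = 0\<^sub>v n"
  then have "K' *\<^sub>v (K *\<^sub>v v) = 0\<^sub>v n" using K' by (auto intro!: eq_vecI)
  then show "v = 0\<^sub>v n" using assoc_mult_mat_vec[OF K' K v] inv v by simp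
qed (use K in \<open>auto intro!: eq_vecI\<close>)

theorem theorem1:
  fixes n :: nat and L J P Lc :: "real mat" and \<mu> :: complex
  assumes "0 < n"
    and "standardized_laplacian n L"
    and "J = mat n n (\<lambda>(i, j). 1 / real n)"
    and "P = L + J"
    and "Lc = (1\<^sub>m n - J) - L"
    and "\<mu> \<notin> {0, 1}"
  shows "(eigenvalue (cmat L) \<mu> \<longleftrightarrow> eigenvalue (cmat P) \<mu>) \<and>
         (eigenvalue (cmat P) \<mu> \<longleftrightarrow> eigenvalue (cmat Lc) (1 - \<mu>)) \<and>
         (eigenvalue (cmat L) \<mu> \<longrightarrow>
            geometric_multiplicity (cmat L) \<mu> = geometric_multiplicity (cmat P) \<mu> \<and>
            geometric_multiplicity (cmat P) \<mu> = geometric_multiplicity (cmat Lc) (1 - \<mu>)) \<and>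
         (\<forall>v \<in> carrier_vec n. \<forall>x.
            x = (1\<^sub>m n - (1 / (1 - \<mu>)) \<cdot>\<^sub>m cmat J) *\<^sub>v v \<longrightarrow>
            (eigenvector (cmat L) v \<mu> \<longleftrightarrow>
               eigenvector (cmat P) x \<mu> \<and> eigenvector (cmat Lc) x (1 - \<mu>)))"
proof -
  have L: "L \<in> carrier_mat n n" and rows: "\<And>i. i < n \<Longrightarrow> (\<Sum>j<n. L $$ (i, j)) = 0"
    using assms(2) by (auto simp: standardized_laplacian_def)
  have J: "J \<in> carrier_mat n n" using assms(3) by simp
  have LJ: "L * J = 0\<^sub>m n n"
  proof (rule eq_matI)
    fix i j assume "i < dim_row (0\<^sub>m n n :: real mat)" "j < dim_col (0\<^sub>m n n :: real mat)"
    then have ij: "i < n" "j < n" by simp_all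
    \<comment> \<open>Every entry of \<open>J\<close> is 1/n, so each entry of the product is a row
      sum of \<open>L\<close> divided by n.\<close>
    have "(L * J) $$ (i, j) = (\<Sum>k<n. L $$ (i, k)) / real n"
      using ij L assms(3) by (simp add: scalar_prod_def atLeast0LessThan sum_divide_distrib)
    then show "(L * J) $$ (i, j) = 0\<^sub>m n n $$ (i, j)" using rows ij by simp
  qed (use L J in auto)
  have JJ: "J * J = J"
    unfolding assms(3) using assms(1) by (intro eq_matI) (auto simp: scalar_prod_def)
  have cL: "cmat L \<in> carrier_mat n n" and cJ: "cmat J \<in> carrier_mat n n" using L J by auto
  \<comment> \<open>The eigenvalues are complex, so the real identities are transported along the
    ring homomorphism \<open>of_real\<close>.\<close>
  have cLJ: "cmat L * cmat J = 0\<^sub>m n n"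
    unfolding of_real_hom.mat_hom_mult[OF L J, symmetric] LJ by (auto intro!: eq_matI)
  have cJJ: "cmat J * cmat J = cmat J"
    using of_real_hom.mat_hom_mult[OF J J] JJ by metis
  have cP: "cmat P = cmat L + cmat J"
    using L J assms(4) by (intro eq_matI) auto
  have cLc: "cmat Lc = (1\<^sub>m n - cmat J) - cmat L"
    using L J assms(5) by (intro eq_matI) auto
  have P: "cmat P \<in> carrier_mat n n" and Lc: "cmat Lc \<in> carrier_mat n n"
    using cL cJ unfolding cP cLc by auto
  define K K' where "K = 1\<^sub>m n - (1 / (1 - \<mu>)) \<cdot>\<^sub>m cmat J" and "K' = 1\<^sub>m n - (1 / \<mu>) \<cdot>\<^sub>m cmat J"
  have K: "K \<in> carrier_mat n n" and K': "K' \<in> carrier_mat n n"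
    using cJ unfolding K_def K'_def by auto
  have \<mu>: "\<mu> \<noteq> 0" "\<mu> \<noteq> 1" using assms(6) by auto
  \<comment> \<open>Both the sum and the product of 1 / (1 - \<mu>) and 1 / \<mu> equal 1 / (\<mu>
    (1 - \<mu>)); here \<mu> must differ from 0 and from 1.\<close>
  have KK': "K * K' = 1\<^sub>m n" and K'K: "K' * K = 1\<^sub>m n"
    unfolding K_def K'_def using \<mu>
    by (intro one_minus_smult_idempotent_mult[OF cJ cJJ]; simp add: field_simps)+
  have NK: "char_matrix (cmat P) \<mu> * K = char_matrix (cmat L) \<mu>"
    unfolding cP K_def by (rule char_matrix_add_mult_one_minus_smult[OF cL cJ cLJ cJJ \<mu>(2)])
  have kerLc: "mat_kernel (char_matrix (cmat Lc) (1 - \<mu>)) = mat_kernel (char_matrix (cmat P) \<mu>)"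
    unfolding cLc cP char_matrix_complement[OF cL cJ] by (rule mat_kernel_uminus)
  have evLc: "eigenvector (cmat Lc) x (1 - \<mu>) \<longleftrightarrow> eigenvector (cmat P) x \<mu>" for x
    by (simp add: eigenvector_mat_kernel[OF Lc] eigenvector_mat_kernel[OF P] kerLc)
  have evP: "eigenvector (cmat L) v \<mu> \<longleftrightarrow> eigenvector (cmat P) (K *\<^sub>v v) \<mu>"
    if v: "v \<in> carrier_vec n" for v
  proof -
    \<comment> \<open>By \<open>NK\<close>, the two sides of the eigenvector equations agree as
      vectors, so one vanishes exactly when the other does.\<close>
    have "char_matrix (cmat L) \<mu> *\<^sub>v v = char_matrix (cmat P) \<mu> *\<^sub>v (K *\<^sub>v v)"
      unfolding NK[symmetric] by (rule assoc_mult_mat_vec[OF char_matrix_closed[OF P] K v])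
    then show ?thesis
      using v K mult_invertible_mat_vec_eq_0_iff[OF K K' K'K v]
      by (simp add: eigenvector_char_matrix[OF cL] eigenvector_char_matrix[OF P])
  qed
  have "eigenvalue (cmat L) \<mu> \<longleftrightarrow> eigenvalue (cmat P) \<mu>"
  proof
    assume "eigenvalue (cmat L) \<mu>"
    then obtain v where "eigenvector (cmat L) v \<mu>" by (auto simp: eigenvalue_def)
    moreover from this have "v \<in> carrier_vec n" using cL by (auto simp: eigenvector_def)
    ultimately show "eigenvalue (cmat P) \<mu>" using evP by (auto simp: eigenvalue_def)
  next
    assume "eigenvalue (cmat P) \<mu>"
    then obtain x where x: "eigenvector (cmat P) x \<mu>" by (auto simp: eigenvalue_def)
    then have xc: "x \<in> carrier_vec n" using P by (auto simp: eigenvector_def)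
    \<comment> \<open>The eigenvector of \<open>L\<close> to exhibit is the preimage of
      \<open>x\<close> under \<open>K\<close>.\<close>
    then have "K *\<^sub>v (K' *\<^sub>v x) = x" using assoc_mult_mat_vec[OF K K' xc] KK' by simp
    then have "eigenvector (cmat L) (K' *\<^sub>v x) \<mu>" using evP[of "K' *\<^sub>v x"] x xc K' by simp
    then show "eigenvalue (cmat L) \<mu>" by (auto simp: eigenvalue_def)
  qed
  moreover have "eigenvalue (cmat P) \<mu> \<longleftrightarrow> eigenvalue (cmat Lc) (1 - \<mu>)"
    by (simp add: eigenvalue_def evLc)
  \<comment> \<open>Right multiplication by the invertible \<open>K\<close> preserves the kernel
    dimension, and \<open>NK\<close> identifies the product.\<close>
  moreover have "geometric_multiplicity (cmat L) \<mu> = geometric_multiplicity (cmat P) \<mu>"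
    using mat_kernel_dim_mult_eq_right[OF char_matrix_closed[OF P, of \<mu>] K K' KK']
      char_matrix_closed[OF cL, of \<mu>] char_matrix_closed[OF P, of \<mu>]
    by (simp only: geometric_multiplicity_def kernel_dim_def NK carrier_matD)
  \<comment> \<open>Here the kernels themselves are equal, and the matrices have the same number of
    columns.\<close>
  moreover have "geometric_multiplicity (cmat P) \<mu> = geometric_multiplicity (cmat Lc) (1 - \<mu>)"
    using char_matrix_closed[OF Lc, of "1 - \<mu>"] char_matrix_closed[OF P, of \<mu>]
    by (simp only: geometric_multiplicity_def kernel_dim_def kerLc carrier_matD)
  ultimately show ?thesis
    using evLc evP unfolding K_def[symmetric] by blast
qed

end
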